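(* Let $k$ be a nonnegative integer and let $A$ be a set of $k$ integers such that $A\cap(-A)=\emptyset$. For any integer $\alpha$ with $0\le\alpha\le k$, we have $$|\Sigma_{\alpha}(A)| \geq \frac{k(k+1)}{2}-\frac{\alpha(\alpha+1)}{2}+1.$$ This lower bound is optimal, i.e. for every such $k$ and $\alpha$ there is a set $A$ of $k$ integers with $A\cap(-A)=\emptyset$ for which equality holds.
   Context: For a set $A$ of integers, $-A=\{-a : a\in A\}$. For a set $A$ of $k$ integers and an integer $0\le\alpha\le k$, $\Sigma_{\alpha}(A)=\left\{\sum_{a\in A'}a : A'\subset A,\ |A'|\ge\alpha\right\}$ is the set of sums of all elements of those subsets of $A$ having at least $\alpha$ elements; the sum over the empty subset is $0$. *)

theory Defs
  imports Complex_Main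
begin

definition Sigma_sums :: "nat \<Rightarrow> int set \<Rightarrow> int set" where
  "Sigma_sums \<alpha> A = {\<Sum>a\<in>B. a | B. B \<subseteq> A \<and> card B \<ge> \<alpha>}"

(* For a set A of integers, the negated set is the image uminus ` A;
   the library's - A is the set complement. *)

end

theory Submission
  imports Defs
begin

text \<open>
  The lower bound goes by induction on the size of \<open>A\<close>, splitting off the element \<open>d\<close> of
  largest absolute value. Negating \<open>A\<close> negates all its subset sums, so \<open>d\<close> may be taken
  positive. Write \<open>A'\<close> for the rest of \<open>A\<close> and let \<open>k = |A|\<close>.

  The sums of subsets that contain \<open>d\<close> form a translate by \<open>d\<close> of
  \<open>\<Sigma>\<^bsub>\<alpha>-1\<^esub>(A')\<close>. Between the right-hand sides for \<open>(k, \<alpha>)\<close> and for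
  \<open>(k - 1, \<alpha> - 1)\<close> the difference is \<open>k - \<alpha>\<close>, so it suffices to find \<open>k - \<alpha>\<close> sums below
  this translate. Take a subset \<open>B\<close> of \<open>A'\<close> that attains the minimum \<open>m\<close> of
  \<open>\<Sigma>\<^bsub>\<alpha>-1\<^esub>(A')\<close>. Adding one element \<open>x\<close> to \<open>B\<close>, or removing one element \<open>b\<close>
  from it, gives the sum \<open>m + x\<close> or \<open>m - b\<close>; both are below \<open>m + d\<close>, since \<open>d\<close> dominates
  all absolute values in \<open>A'\<close>, and \<open>A \<inter> (-A) = \<emptyset>\<close> makes all of them, and \<open>m\<close> itself,
  distinct. The constraint of having at least \<open>\<alpha>\<close> elements always leaves enough of
  these changes available: this is \<open>Sigma_sums_insert_dominant\<close>. For \<open>\<alpha> = 0\<close> the index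
  \<open>\<alpha> - 1\<close> is read as \<open>0\<close>; the difference of the right-hand sides is then still \<open>k\<close>.

  The bound is attained by \<open>{1..k}\<close>, whose admissible sums all lie between \<open>1 + \<dots> + \<alpha>\<close>
  and \<open>1 + \<dots> + k\<close>.
\<close>

lemma finite_Sigma_sums:
  assumes "finite A"
  shows "finite (Sigma_sums \<alpha> A)"
proof -
  have "Sigma_sums \<alpha> A \<subseteq> (\<lambda>B. \<Sum>a\<in>B. a) ` Pow A"
    by (auto simp: Sigma_sums_def)
  then show ?thesis
    using assms by (meson finite_Pow_iff finite_imageI finite_subset)
qed

lemma Sigma_sums_nonempty:
  assumes "\<alpha> \<le> card A"
  shows "Sigma_sums \<alpha> A \<noteq> {}"
  using assms by (auto simp: Sigma_sums_def)

lemma Sigma_sumsI: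
  assumes "B \<subseteq> A" "\<alpha> \<le> card B" "s = (\<Sum>a\<in>B. a)"
  shows "s \<in> Sigma_sums \<alpha> A"
  using assms by (auto simp: Sigma_sums_def)

lemma Sigma_sums_uminus_subset:
  "uminus ` Sigma_sums \<alpha> A \<subseteq> Sigma_sums \<alpha> (uminus ` A)"
proof
  fix s assume "s \<in> uminus ` Sigma_sums \<alpha> A"
  then obtain B where B: "B \<subseteq> A" "\<alpha> \<le> card B" and s: "s = - (\<Sum>a\<in>B. a)"
    by (auto simp: Sigma_sums_def)
  show "s \<in> Sigma_sums \<alpha> (uminus ` A)"
  proof (rule Sigma_sumsI)
    show "uminus ` B \<subseteq> uminus ` A" using B by auto
    show "\<alpha> \<le> card (uminus ` B)" using B by (simp add: card_image)
    show "s = (\<Sum>a\<in>uminus ` B. a)" by (simp add: s sum.reindex sum_negf)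
  qed
qed

lemma card_Sigma_sums_uminus:
  assumes "finite A"
  shows "card (Sigma_sums \<alpha> (uminus ` A)) = card (Sigma_sums \<alpha> A)"
proof (rule antisym)
  have le: "card (Sigma_sums \<alpha> C) \<le> card (Sigma_sums \<alpha> (uminus ` C))"
    if "finite C" for C
    using card_mono[OF finite_Sigma_sums Sigma_sums_uminus_subset, of C \<alpha>] that
    by (simp add: card_image)
  show "card (Sigma_sums \<alpha> A) \<le> card (Sigma_sums \<alpha> (uminus ` A))"
    by (rule le[OF assms])
  show "card (Sigma_sums \<alpha> (uminus ` A)) \<le> card (Sigma_sums \<alpha> A)"
    using le[of "uminus ` A"] assms by (simp add: image_image)
qed

text \<open>
  The inductive step. The set \<open>E\<close> in the proof collects the changes of the minimal sum
  \<open>m\<close> that come from altering the minimizing subset \<open>B\<close> in at most one element and that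
  keep at least \<open>\<alpha>\<close> elements. If \<open>|B| < \<alpha>\<close>, then \<open>|B| = \<alpha> - 1\<close> and an element has to be
  added, in one of \<open>|A| - |B| = |A| + 1 - \<alpha>\<close> ways. If \<open>|B| = \<alpha>\<close>, leaving \<open>B\<close> as it is makes up for the
  addition that is lost. If \<open>|B| > \<alpha>\<close>, removals are allowed too and \<open>|A| + 1\<close> changes
  are available.
\<close>

lemma Sigma_sums_insert_dominant:
  fixes A :: "int set"
  assumes fin: "finite A" and sym: "A \<inter> uminus ` A = {}"
    and dom: "\<And>x. x \<in> A \<Longrightarrow> \<bar>x\<bar> < d" and pos: "0 < d"
    and \<alpha>: "\<alpha> \<le> Suc (card A)"
  shows "card (Sigma_sums (\<alpha> - 1) A) + (Suc (card A) - \<alpha>)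
           \<le> card (Sigma_sums \<alpha> (insert d A))"
proof -
  define S where "S = Sigma_sums (\<alpha> - 1) A"
  define m where "m = Min S"
  have finS: "finite S" unfolding S_def by (rule finite_Sigma_sums[OF fin])
  have "S \<noteq> {}" unfolding S_def using \<alpha> by (intro Sigma_sums_nonempty) simp
  then have "m \<in> S" unfolding m_def using finS by simp
  then obtain B where B: "B \<subseteq> A" "\<alpha> - 1 \<le> card B" and m: "m = (\<Sum>a\<in>B. a)"
    by (auto simp: S_def Sigma_sums_def)
  have finB: "finite B" using B(1) fin by (rule finite_subset)
  have dA: "d \<notin> A" using dom pos by force
  have cardAB: "card (A - B) + card B = card A"
    using B(1) fin finB by (metis card_Diff_subset card_mono le_add_diff_inverse2)
  have zero: "0 \<notin> A" using sym by force
  have neg: "- x \<notin> A" if "x \<in> A" for x using sym that by force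

  have with_d: "(+) d ` S \<subseteq> Sigma_sums \<alpha> (insert d A)"
  proof
    fix s assume "s \<in> (+) d ` S"
    then obtain C where C: "C \<subseteq> A" "\<alpha> - 1 \<le> card C" and s: "s = d + (\<Sum>a\<in>C. a)"
      by (auto simp: S_def Sigma_sums_def)
    have "finite C" "d \<notin> C" using C(1) fin dA by (auto intro: finite_subset)
    then show "s \<in> Sigma_sums \<alpha> (insert d A)"
      using C s by (intro Sigma_sumsI[of "insert d C"]) auto
  qed

  have add_one: "m + x \<in> Sigma_sums \<alpha> (insert d A)" if "x \<in> A - B" for x
    using that B finB m by (intro Sigma_sumsI[of "insert x B"]) auto
  have keep: "m + 0 \<in> Sigma_sums \<alpha> (insert d A)" if "\<alpha> \<le> card B"
    using that B m by (intro Sigma_sumsI[of B]) auto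
  have remove_one: "m + - b \<in> Sigma_sums \<alpha> (insert d A)"
    if "\<alpha> < card B" "b \<in> B" for b
    using that B finB m by (intro Sigma_sumsI[of "B - {b}"]) (auto simp: sum_diff1)

  define E where "E = (A - B) \<union> (if \<alpha> \<le> card B then {0} else {})
                        \<union> (if \<alpha> < card B then uminus ` B else {})"
  have finE: "finite E" using fin finB by (simp add: E_def)
  have E_small: "e < d" if "e \<in> E" for e
    using that dom pos B(1) by (force simp: E_def split: if_splits)
  have cardE: "Suc (card A) - \<alpha> \<le> card E"
  proof -
    have "0 \<notin> A - B" using zero by simp
    have "0 \<notin> uminus ` B" "(A - B) \<inter> uminus ` B = {}"
      using zero neg B(1) by auto
    then have "card (insert 0 ((A - B) \<union> uminus ` B)) = Suc (card (A - B) + card B)"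
      using \<open>0 \<notin> A - B\<close> fin finB by (simp add: card_Un_disjoint card_image)
    moreover have "card (insert 0 (A - B)) = Suc (card (A - B))"
      using \<open>0 \<notin> A - B\<close> fin by simp
    ultimately show ?thesis
      using cardAB B(2) by (simp add: E_def) linarith
  qed
  have low: "(+) m ` E \<subseteq> Sigma_sums \<alpha> (insert d A)"
    using add_one keep remove_one by (auto simp: E_def split: if_splits)

  have "(+) d ` S \<inter> (+) m ` E = {}"
  proof -
    have "m + e < d + s" if "e \<in> E" "s \<in> S" for e s
      using E_small[OF that(1)] Min_le[OF finS that(2)] by (simp add: m_def)
    then show ?thesis by fastforce
  qed
  then have "card S + card E = card ((+) d ` S \<union> (+) m ` E)"
    using finS finE by (simp add: card_Un_disjoint card_image)
  also have "\<dots> \<le> card (Sigma_sums \<alpha> (insert d A))"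
    using with_d low fin by (intro card_mono finite_Sigma_sums) auto
  finally show ?thesis using cardE by (simp add: S_def)
qed

text \<open>
  The inequality is doubled and rearranged so that it lives in the natural numbers without
  division or subtraction.
\<close>

lemma card_Sigma_sums_lower_bound:
  fixes A :: "int set"
  assumes "finite A" "A \<inter> uminus ` A = {}" "\<alpha> \<le> card A"
  shows "card A * (card A + 1) + 2 \<le> 2 * card (Sigma_sums \<alpha> A) + \<alpha> * (\<alpha> + 1)"
  using assms
proof (induction "card A" arbitrary: A \<alpha>)
  case 0
  then have "card (Sigma_sums \<alpha> A) \<noteq> 0"
    using finite_Sigma_sums Sigma_sums_nonempty by (metis card_0_eq)
  then show ?case using 0 by simp
next
  case (Suc n)
  have positive_max: ?case
    if C: "finite C" "C \<inter> uminus ` C = {}" "card C = Suc n"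
      "card (Sigma_sums \<alpha> C) = card (Sigma_sums \<alpha> A)"
      and d: "d \<in> C" "0 < d" "\<And>x. x \<in> C \<Longrightarrow> \<bar>x\<bar> \<le> d" for C d
  proof -
    define C' where "C' = C - {d}"
    have C': "finite C'" "C' \<inter> uminus ` C' = {}" "card C' = n" "insert d C' = C"
      using C d by (auto simp: C'_def)
    have strict: "\<bar>x\<bar> < d" if "x \<in> C'" for x
    proof -
      have "- d \<notin> C" using C(2) d(1) by force
      then have "x \<noteq> - d" "x \<noteq> d" using that by (auto simp: C'_def)
      then show ?thesis using d(3)[of x] that by (auto simp: C'_def)
    qed
    have "\<alpha> \<le> Suc n" using Suc by simp
    then have step: "card (Sigma_sums (\<alpha> - 1) C') + (Suc n - \<alpha>) \<le> card (Sigma_sums \<alpha> A)"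
      using Sigma_sums_insert_dominant[OF C'(1,2) strict d(2), of \<alpha>] C'(3,4) C(4) by simp
    have IH: "n * (n + 1) + 2 \<le> 2 * card (Sigma_sums (\<alpha> - 1) C') + (\<alpha> - 1) * (\<alpha> - 1 + 1)"
      using Suc.hyps(1)[of C' "\<alpha> - 1"] C'(1,2,3) \<open>\<alpha> \<le> Suc n\<close> by simp
    have gain: "Suc n * (Suc n + 1) + (\<alpha> - 1) * (\<alpha> - 1 + 1)
                  = n * (n + 1) + 2 * (Suc n - \<alpha>) + \<alpha> * (\<alpha> + 1)"
      using \<open>\<alpha> \<le> Suc n\<close> by (cases \<alpha>) (auto simp: algebra_simps)
    have "Suc n * (Suc n + 1) + 2 \<le> 2 * card (Sigma_sums \<alpha> A) + \<alpha> * (\<alpha> + 1)"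
      using step IH gain by linarith
    then show ?thesis by (simp only: Suc.hyps(2))
  qed
  have "finite (abs ` A)" "abs ` A \<noteq> {}" using Suc by auto
  then obtain a where a: "a \<in> A" "\<And>x. x \<in> A \<Longrightarrow> \<bar>x\<bar> \<le> \<bar>a\<bar>"
    by (smt (verit) Max_ge Max_in imageE imageI)
  have "a \<noteq> 0" using a(1) Suc.prems(2) by force
  show ?case
  proof (cases "0 < a")
    case True
    then show ?thesis
      using positive_max[of A a] a Suc by simp
  next
    case False
    then have "0 < - a" "\<bar>a\<bar> = - a" using \<open>a \<noteq> 0\<close> by auto
    moreover have "\<bar>x\<bar> \<le> - a" if "x \<in> uminus ` A" for x
      using that a(2) \<open>\<bar>a\<bar> = - a\<close> by force
    ultimately show ?thesis
      using a(1) Suc.prems Suc.hyps(2)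
      by (intro positive_max[of "uminus ` A" "- a"])
         (auto simp: card_Sigma_sums_uminus card_image image_image Int_commute)
  qed
qed

lemma sum_positive_ints_ge_triangular:
  fixes B :: "int set"
  assumes "finite B" "\<And>b. b \<in> B \<Longrightarrow> 0 < b"
  shows "int (card B) * (int (card B) + 1) \<le> 2 * (\<Sum>b\<in>B. b)"
  using assms
proof (induction rule: finite_linorder_max_induct)
  case empty
  then show ?case by simp
next
  case (insert b B)
  \<comment> \<open>the largest element is at least the size of the set\<close>
  have "insert b B \<subseteq> {1..b}" using insert by fastforce
  then have "card (insert b B) \<le> nat b"
    by (metis card_atLeastAtMost_int card_mono diff_add_cancel finite_atLeastAtMost_int)
  moreover have "b \<notin> B" using insert by auto
  ultimately have "int (card B) + 1 \<le> b" using insert by simp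
  then show ?case using insert \<open>b \<notin> B\<close> by (simp add: algebra_simps)
qed

lemma sum_initial_ints: "2 * (\<Sum>a\<in>{1..int k}. a) = int k * (int k + 1)"
proof (induction k)
  case (Suc k)
  have "{1..int (Suc k)} = insert (int k + 1) {1..int k}" by auto
  then show ?case using Suc by (simp add: algebra_simps)
qed simp

lemma card_Sigma_sums_initial:
  assumes "\<alpha> \<le> k"
  shows "2 * card (Sigma_sums \<alpha> {1..int k}) + \<alpha> * (\<alpha> + 1) \<le> k * (k + 1) + 2"
proof -
  define T where "T n = int n * (int n + 1) div 2" for n
  have T: "2 * T n = int n * (int n + 1)" for n by (simp add: T_def)
  have mono: "int \<alpha> * (int \<alpha> + 1) \<le> int n * (int n + 1)" if "\<alpha> \<le> n" for n
    using that by (intro mult_mono) auto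
  have "Sigma_sums \<alpha> {1..int k} \<subseteq> {T \<alpha>..T k}"
  proof
    fix s assume "s \<in> Sigma_sums \<alpha> {1..int k}"
    then obtain B where B: "B \<subseteq> {1..int k}" "\<alpha> \<le> card B" and s: "s = (\<Sum>a\<in>B. a)"
      by (auto simp: Sigma_sums_def)
    have "finite B" using B(1) by (rule finite_subset) simp
    moreover have "0 < b" if "b \<in> B" for b using that B(1) by fastforce
    ultimately have "int (card B) * (int (card B) + 1) \<le> 2 * s"
      using sum_positive_ints_ge_triangular s by blast
    then have "2 * T \<alpha> \<le> 2 * s" using mono[OF B(2)] T[of \<alpha>] by linarith
    moreover have "s \<le> (\<Sum>a\<in>{1..int k}. a)"
      unfolding s using B(1) by (intro sum_mono2) auto
    ultimately show "s \<in> {T \<alpha>..T k}" using sum_initial_ints[of k] T[of k] by simp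
  qed
  then have "card (Sigma_sums \<alpha> {1..int k}) \<le> card {T \<alpha>..T k}"
    by (intro card_mono) auto
  moreover have "2 * T \<alpha> \<le> 2 * T k" using mono[OF assms] T by simp
  ultimately have "int (card (Sigma_sums \<alpha> {1..int k})) \<le> T k - T \<alpha> + 1" by simp
  then have "2 * int (card (Sigma_sums \<alpha> {1..int k})) + 2 * T \<alpha> \<le> 2 * T k + 2" by simp
  then have "int (2 * card (Sigma_sums \<alpha> {1..int k}) + \<alpha> * (\<alpha> + 1)) \<le> int (k * (k + 1) + 2)"
    unfolding T by (simp add: algebra_simps)
  then show ?thesis by (simp only: of_nat_le_iff)
qed

theorem theorem4:
  fixes k \<alpha> :: nat
  assumes "\<alpha> \<le> k"
  shows "(\<forall>A :: int set. finite A \<and> card A = k \<and> A \<inter> uminus ` A = {} \<longrightarrow>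
            real (card (Sigma_sums \<alpha> A)) \<ge>
              real k * (real k + 1) / 2 - real \<alpha> * (real \<alpha> + 1) / 2 + 1)
       \<and> (\<exists>A :: int set. finite A \<and> card A = k \<and> A \<inter> uminus ` A = {} \<and>
            real (card (Sigma_sums \<alpha> A)) =
              real k * (real k + 1) / 2 - real \<alpha> * (real \<alpha> + 1) / 2 + 1)"
proof -
  have lower: "real (card (Sigma_sums \<alpha> A)) \<ge>
      real k * (real k + 1) / 2 - real \<alpha> * (real \<alpha> + 1) / 2 + 1"
    if "finite A" "card A = k" "A \<inter> uminus ` A = {}" for A :: "int set"
  proof -
    have "real (k * (k + 1) + 2) \<le> real (2 * card (Sigma_sums \<alpha> A) + \<alpha> * (\<alpha> + 1))"
      using card_Sigma_sums_lower_bound[of A \<alpha>] that assms by (simp only: of_nat_le_iff)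
    then show ?thesis by (simp add: field_simps)
  qed
  let ?I = "{1..int k}"
  have I: "finite ?I" "card ?I = k" "?I \<inter> uminus ` ?I = {}" by auto
  have "real (2 * card (Sigma_sums \<alpha> ?I) + \<alpha> * (\<alpha> + 1)) \<le> real (k * (k + 1) + 2)"
    using card_Sigma_sums_initial[OF assms] by (simp only: of_nat_le_iff)
  then have "real (card (Sigma_sums \<alpha> ?I)) \<le>
      real k * (real k + 1) / 2 - real \<alpha> * (real \<alpha> + 1) / 2 + 1"
    by (simp add: field_simps)
  with lower[OF I] have "real (card (Sigma_sums \<alpha> ?I)) =
      real k * (real k + 1) / 2 - real \<alpha> * (real \<alpha> + 1) / 2 + 1"
    by (rule antisym[rotated])
  with I lower show ?thesis by blast
qed

end
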